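(* If $D$ is a digraph without odd directed cycles, then $D$ is majority $2$-choosable.
   Context: Digraphs are finite, loopless, have no parallel edges, but may have anti-parallel pairs of edges (digons). An odd directed cycle is a directed cycle of odd length. $N^+(v)$ denotes the set of out-neighbors of $v$. A majority coloring of $D$ is a vertex-coloring $c$ such that for every $v\in V(D)$, at most half of the out-neighbors $w\in N^+(v)$ satisfy $c(w)=c(v)$. $D$ is majority $k$-choosable if for every assignment of lists $L(v)$ of colors with $|L(v)|\ge k$ to the vertices $v\in V(D)$, there is a majority coloring $c$ of $D$ with $c(v)\in L(v)$ for all $v\in V(D)$. *)

theory Defs
  imports "Graph_Theory.Arc_Walk"
begin

definition out_neighbors :: "('a, 'b) pre_digraph \<Rightarrow> 'a \<Rightarrow> 'a set" where
  "out_neighbors D v = {w. v \<rightarrow>\<^bsub>D\<^esub> w}"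

definition majority_coloring :: "('a, 'b) pre_digraph \<Rightarrow> ('a \<Rightarrow> 'c) \<Rightarrow> bool" where
  "majority_coloring D c \<longleftrightarrow>
    (\<forall>v \<in> verts D. 2 * card {w \<in> out_neighbors D v. c w = c v} \<le> card (out_neighbors D v))"

text \<open>
  The type argument is the type of colors; it has to be passed explicitly because the
  lists and the coloring are quantified inside the definition. Lists may be infinite:
  since \<^const>\<open>card\<close> is 0 on infinite sets, the requirement that a list
  has at least \<open>k\<close> elements needs a separate disjunct for them.
\<close>

definition majority_choosable :: "'c itself \<Rightarrow> ('a, 'b) pre_digraph \<Rightarrow> nat \<Rightarrow> bool" where
  "majority_choosable _ D k \<longleftrightarrow>
    (\<forall>L :: 'a \<Rightarrow> 'c set.
      (\<forall>v \<in> verts D. infinite (L v) \<or> k \<le> card (L v)) \<longrightarrow>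
      (\<exists>c :: 'a \<Rightarrow> 'c. majority_coloring D c \<and> (\<forall>v \<in> verts D. c v \<in> L v)))"

end

theory Submission
  imports Defs
begin

text \<open>
  The colors are processed one at a time. When color \<open>a\<close> has its turn, let \<open>S\<close> be the set of
  still undecided vertices whose list (of size two) contains \<open>a\<close>, and let \<open>F\<close> be the set of
  vertices already forced to take \<open>a\<close>. Suppose that there is a set \<open>K \<subseteq> S\<close> such that a vertex of
  \<open>S\<close> lies in \<open>K\<close> exactly when at most half of its out-neighbors lie in \<open>K \<union> F\<close>. Give \<open>a\<close> to
  precisely the vertices of \<open>K \<union> F\<close>. The vertices of \<open>K\<close> are then satisfied for good. A vertex
  of \<open>S - K\<close> is forced to the other color of its list, but it is satisfied too: more
  than half of its out-neighbors have color \<open>a\<close>, so any other color occurs on fewer than half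
  of them. Nothing more has to be known about forced vertices, so the remaining colors can be
  treated in the same way (lemma \<open>list_coloring_from_kernels\<close>).

  Such a set \<open>K\<close> is a fixed point of a Boolean network in which every vertex reacts
  antitonically to its out-neighbors. If the digraph is bipartite, complementing the states on
  one side makes the network monotone, and Knaster--Tarski supplies a fixed point
  (lemma \<open>bipartite_antitone_fixed_point\<close>). In general, a sink strong component is bipartite
  because closed walks have even length; it can be solved on its own, and its
  solution becomes part of the constraints for the rest
  (lemma \<open>antitone_fixed_point\<close>).
\<close>

section \<open>Odd closed walks contain odd cycles\<close>

text \<open>
  A closed walk that is not a cycle splits at a repeated vertex into two shorter
  closed walks, and one of them is again odd.
\<close>

lemma (in wf_digraph) odd_closed_walk_imp_odd_cycle:
  assumes "awalk u p u" "odd (length p)"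
  shows "\<exists>q. cycle q \<and> odd (length q)"
  using assms
proof (induction "length p" arbitrary: u p rule: less_induct)
  case less
  show ?case
  proof (cases "distinct (tl (awalk_verts u p))")
    case True
    moreover have "p \<noteq> []" using less.prems(2) by auto
    ultimately show ?thesis using less.prems unfolding cycle_def by blast
  next
    case False
    obtain e p' where p: "p = e # p'" using less.prems(2) by (cases p) auto
    have walk: "awalk (head G e) p' u" and e: "e \<in> arcs G" "tail G e = u"
      using less.prems(1) p by (auto simp: awalk_Cons_iff)
    have "\<not> distinct (awalk_verts (head G e) p')"
      using False p by simp
    from awalk_not_distinct_decomp[OF walk this] obtain q r s w where
      p': "p' = q @ r @ s" and "r \<noteq> []"
      and q: "awalk (head G e) q w" and r: "awalk w r w" and s: "awalk w s u"
      by auto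
    show ?thesis
    proof (cases "odd (length r)")
      case True
      show ?thesis by (rule less.hyps[OF _ r True]) (simp add: p p')
    next
      case False
      have "awalk u (e # q @ s) u" using q s e by (auto simp: awalk_Cons_iff)
      moreover have "odd (length (e # q @ s))" using False less.prems(2) by (simp add: p p')
      ultimately show ?thesis using less.hyps[of "e # q @ s" u] \<open>r \<noteq> []\<close> by (simp add: p p')
    qed
  qed
qed

lemma (in wf_digraph) awalk_of_relpow_arcs_ends:
  assumes "(u, v) \<in> arcs_ends G ^^ n" "u \<in> verts G"
  shows "\<exists>p. awalk u p v \<and> length p = n"
  using assms
proof (induction n arbitrary: v)
  case 0
  then show ?case by (auto simp: awalk_Nil_iff)
next
  case (Suc n)
  then obtain w where "(u, w) \<in> arcs_ends G ^^ n" "(w, v) \<in> arcs_ends G" by auto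
  moreover from this obtain e where "e \<in> arcs G" "tail G e = w" "head G e = v"
    by (auto simp: arcs_ends_def arc_to_ends_def)
  moreover obtain p where "awalk u p w" "length p = n" using Suc calculation by blast
  ultimately have "awalk u (p @ [e]) v \<and> length (p @ [e]) = Suc n"
    by (auto simp: awalk_Cons_iff awalk_Nil_iff)
  then show ?case by blast
qed

section \<open>Fixed points of antitone networks\<close>

text \<open>
  Complementing the states on the side \<open>B\<close> turns the network into a monotone map, because every
  dependency crosses from one side to the other.
\<close>

lemma bipartite_antitone_fixed_point:
  fixes E :: "('a \<times> 'a) set" and P :: "'a \<Rightarrow> 'a set \<Rightarrow> bool"
  assumes anti: "\<And>v X Y. X \<subseteq> Y \<Longrightarrow> P v Y \<Longrightarrow> P v X"
    and dep: "\<And>v X. P v X \<longleftrightarrow> P v (X \<inter> E `` {v})"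
    and disj: "A \<inter> B = {}"
    and AB: "\<And>v w. v \<in> A \<Longrightarrow> (v, w) \<in> E \<Longrightarrow> w \<notin> A"
    and BA: "\<And>v w. v \<in> B \<Longrightarrow> (v, w) \<in> E \<Longrightarrow> w \<notin> B"
  shows "\<exists>K \<subseteq> A \<union> B. \<forall>v \<in> A \<union> B. v \<in> K \<longleftrightarrow> P v K"
proof -
  define h where "h Z = {v \<in> A. P v (B - Z)} \<union> {v \<in> B. \<not> P v (Z \<inter> A)}" for Z
  have "mono h"
  proof (rule monoI)
    fix X Y :: "'a set"
    assume "X \<subseteq> Y"
    then have "B - Y \<subseteq> B - X" "X \<inter> A \<subseteq> Y \<inter> A" by auto
    then show "h X \<subseteq> h Y" unfolding h_def using anti by blast
  qed
  define Z where "Z = lfp h"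
  have Z: "Z = h Z" unfolding Z_def using lfp_unfold[OF \<open>mono h\<close>] .
  define K where "K = (Z \<inter> A) \<union> (B - Z)"
  have "v \<in> K \<longleftrightarrow> P v K" if "v \<in> A" for v
  proof -
    have "K \<inter> E `` {v} = (B - Z) \<inter> E `` {v}" using AB[OF that] by (auto simp: K_def)
    then have "P v K \<longleftrightarrow> P v (B - Z)" using dep by metis
    moreover have "v \<in> K \<longleftrightarrow> v \<in> h Z" using that disj Z by (auto simp: K_def)
    ultimately show ?thesis using that disj by (auto simp: h_def)
  qed
  moreover have "v \<in> K \<longleftrightarrow> P v K" if "v \<in> B" for v
  proof -
    have "K \<inter> E `` {v} = (Z \<inter> A) \<inter> E `` {v}" using BA[OF that] by (auto simp: K_def)
    then have "P v K \<longleftrightarrow> P v (Z \<inter> A)" using dep by metis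
    moreover have "v \<in> K \<longleftrightarrow> v \<notin> h Z" using that disj Z by (auto simp: K_def)
    ultimately show ?thesis using that disj by (auto simp: h_def)
  qed
  moreover have "K \<subseteq> A \<union> B" by (auto simp: K_def)
  ultimately show ?thesis by blast
qed

text \<open>
  A vertex whose set of reachable vertices is as small as possible generates a strong
  component that no arc leaves.
\<close>

lemma sink_strong_component:
  fixes R :: "('a \<times> 'a) set"
  assumes "finite S" "S \<noteq> {}" "R \<subseteq> S \<times> S"
  obtains r where "r \<in> S" "\<And>w. (r, w) \<in> R\<^sup>* \<Longrightarrow> (w, r) \<in> R\<^sup>*"
proof -
  have reach: "R\<^sup>* `` {x} \<subseteq> S" if "x \<in> S" for x
  proof
    fix w
    assume "w \<in> R\<^sup>* `` {x}"
    then have "(x, w) \<in> R\<^sup>*" by simp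
    then show "w \<in> S" by (induction rule: rtrancl_induct) (use that assms(3) in auto)
  qed
  obtain r where r: "r \<in> S" "\<And>x. x \<in> S \<Longrightarrow> card (R\<^sup>* `` {r}) \<le> card (R\<^sup>* `` {x})"
    using assms(2) ex_has_least_nat[of "\<lambda>x. x \<in> S" _ "\<lambda>x. card (R\<^sup>* `` {x})"] by blast
  have "(w, r) \<in> R\<^sup>*" if "(r, w) \<in> R\<^sup>*" for w
  proof -
    have "R\<^sup>* `` {w} \<subseteq> R\<^sup>* `` {r}" using that by auto
    moreover have "card (R\<^sup>* `` {r}) \<le> card (R\<^sup>* `` {w})" using r reach[OF r(1)] that by auto
    moreover have "finite (R\<^sup>* `` {r})" using reach[OF r(1)] assms(1) finite_subset by blast
    ultimately have "R\<^sup>* `` {w} = R\<^sup>* `` {r}" by (meson card_seteq)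
    then show ?thesis by auto
  qed
  with r(1) that show thesis by blast
qed

text \<open>
  In a sink strong component \<open>T\<close>, no vertex is reached from a root by both an even and an odd
  walk: one walk back to the root would close both, and one of the closed walks would be odd.
  So \<open>T\<close> is bipartite and can be solved; no vertex of \<open>T\<close> depends on the rest of \<open>S\<close>, so that the solution on \<open>T\<close>
  may be hard-wired into the network for \<open>S - T\<close>.
\<close>

lemma antitone_fixed_point:
  fixes E :: "('a \<times> 'a) set" and P :: "'a \<Rightarrow> 'a set \<Rightarrow> bool"
  assumes even_closed: "\<And>x n. (x, x) \<in> E ^^ n \<Longrightarrow> even n"
    and "finite S"
    and "\<And>v X Y. X \<subseteq> Y \<Longrightarrow> P v Y \<Longrightarrow> P v X"
    and "\<And>v X. P v X \<longleftrightarrow> P v (X \<inter> E `` {v})"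
  shows "\<exists>K \<subseteq> S. \<forall>v \<in> S. v \<in> K \<longleftrightarrow> P v K"
  using assms(2-)
proof (induction S arbitrary: P rule: finite_psubset_induct)
  case (psubset S)
  note anti = psubset.prems(1) and dep = psubset.prems(2)
  show ?case
  proof (cases "S = {}")
    case True
    then show ?thesis by auto
  next
    case False
    define R where "R = E \<inter> S \<times> S"
    obtain r where r: "r \<in> S" and returns: "\<And>w. (r, w) \<in> R\<^sup>* \<Longrightarrow> (w, r) \<in> R\<^sup>*"
      using sink_strong_component[of S R] psubset.hyps False unfolding R_def by blast
    define A where "A = {w. \<exists>n. even n \<and> (r, w) \<in> R ^^ n}"
    define B where "B = {w. \<exists>n. odd n \<and> (r, w) \<in> R ^^ n}"
    define T where "T = A \<union> B"
    have T: "T = R\<^sup>* `` {r}"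
    proof (rule set_eqI)
      fix w
      have "w \<in> T \<longleftrightarrow> (\<exists>n. (r, w) \<in> R ^^ n)" unfolding T_def A_def B_def by blast
      then show "w \<in> T \<longleftrightarrow> w \<in> R\<^sup>* `` {r}" by (simp add: rtrancl_power)
    qed
    have "r \<in> T" by (simp add: T)
    have "T \<subseteq> S"
    proof
      fix w
      assume "w \<in> T"
      then have "(r, w) \<in> R\<^sup>*" by (simp add: T)
      then show "w \<in> S" by (induction rule: rtrancl_induct) (use r in \<open>auto simp: R_def\<close>)
    qed
    have closed: "w \<in> T" if "v \<in> T" "(v, w) \<in> E" "w \<in> S" for v w
    proof -
      have "(v, w) \<in> R" using that \<open>T \<subseteq> S\<close> by (auto simp: R_def)
      then show ?thesis using that(1) by (auto simp: T)
    qed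
    have even_R: "even n" if "(x, x) \<in> R ^^ n" for x n
    proof -
      have "R ^^ n \<subseteq> E ^^ n" by (induction n) (simp_all add: R_def relcomp_mono)
      then show ?thesis using even_closed that by blast
    qed
    have disj: "A \<inter> B = {}"
    proof (rule ccontr)
      assume "A \<inter> B \<noteq> {}"
      then obtain w m n where w: "even m" "(r, w) \<in> R ^^ m" "odd n" "(r, w) \<in> R ^^ n"
        unfolding A_def B_def by blast
      then have "(w, r) \<in> R\<^sup>*" using returns relpow_imp_rtrancl by metis
      then obtain k where "(w, r) \<in> R ^^ k" using rtrancl_imp_relpow by metis
      then have "(r, r) \<in> R ^^ (m + k)" "(r, r) \<in> R ^^ (n + k)"
        using w(2,4) unfolding relpow_add by (blast intro: relcompI)+
      then have "even (m + k)" "even (n + k)" by (simp_all only: even_R)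
      with w show False by simp
    qed
    have step: "(r, w) \<in> R ^^ Suc n" if "(r, v) \<in> R ^^ n" "(v, w) \<in> E" "v \<in> T" "w \<in> T" for v w n
    proof (rule relpow_Suc_I[OF that(1)])
      show "(v, w) \<in> R" using that(2-) \<open>T \<subseteq> S\<close> by (auto simp: R_def)
    qed
    have AB: "w \<notin> A" if v: "v \<in> A" and "(v, w) \<in> E" for v w
    proof
      assume "w \<in> A"
      then have "v \<in> T" "w \<in> T" using v unfolding T_def by blast+
      obtain n where n: "even n" "(r, v) \<in> R ^^ n" using v unfolding A_def by blast
      have "(r, w) \<in> R ^^ Suc n" by (rule step) fact+
      moreover have "odd (Suc n)" using n(1) by simp
      ultimately have "w \<in> B" unfolding B_def by blast
      with \<open>w \<in> A\<close> disj show False by blast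
    qed
    have BA: "w \<notin> B" if v: "v \<in> B" and "(v, w) \<in> E" for v w
    proof
      assume "w \<in> B"
      then have "v \<in> T" "w \<in> T" using v unfolding T_def by blast+
      obtain n where n: "odd n" "(r, v) \<in> R ^^ n" using v unfolding B_def by blast
      have "(r, w) \<in> R ^^ Suc n" by (rule step) fact+
      moreover have "even (Suc n)" using n(1) by simp
      ultimately have "w \<in> A" unfolding A_def by blast
      with \<open>w \<in> B\<close> disj show False by blast
    qed
    have "\<exists>K \<subseteq> T. \<forall>v \<in> T. v \<in> K \<longleftrightarrow> P v K"
      unfolding T_def by (rule bipartite_antitone_fixed_point[of P E, OF anti dep disj AB BA])
    then obtain K where K: "K \<subseteq> T" "\<And>v. v \<in> T \<Longrightarrow> v \<in> K \<longleftrightarrow> P v K" by blast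
    define Q where "Q v X = P v (X \<union> K)" for v X
    have anti_Q: "Q v X" if "X \<subseteq> Y" "Q v Y" for v X Y
      using that anti[of "X \<union> K" "Y \<union> K" v] by (auto simp: Q_def)
    have dep_Q: "Q v X \<longleftrightarrow> Q v (X \<inter> E `` {v})" for v X
    proof -
      have "(X \<union> K) \<inter> E `` {v} = (X \<inter> E `` {v} \<union> K) \<inter> E `` {v}" by auto
      then show ?thesis
        unfolding Q_def using dep[of v "X \<union> K"] dep[of v "X \<inter> E `` {v} \<union> K"] by simp
    qed
    have "S - T \<subset> S" using \<open>r \<in> T\<close> r by blast
    then have "\<exists>L \<subseteq> S - T. \<forall>v \<in> S - T. v \<in> L \<longleftrightarrow> Q v L"
      using anti_Q dep_Q by (rule psubset.IH)
    then obtain L where L: "L \<subseteq> S - T" "\<And>v. v \<in> S - T \<Longrightarrow> v \<in> L \<longleftrightarrow> Q v L" by blast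
    have "v \<in> L \<union> K \<longleftrightarrow> P v (L \<union> K)" if "v \<in> S" for v
    proof (cases "v \<in> T")
      case True
      then have "(L \<union> K) \<inter> E `` {v} = K \<inter> E `` {v}" using L(1) closed by blast
      then have "P v (L \<union> K) \<longleftrightarrow> P v K" using dep[of v "L \<union> K"] dep[of v K] by simp
      then show ?thesis using True K(2) L(1) by blast
    next
      case False
      then show ?thesis using that L(2) K(1) by (auto simp: Q_def)
    qed
    then show ?thesis using K(1) L(1) \<open>T \<subseteq> S\<close> by (intro exI[of _ "L \<union> K"]) auto
  qed
qed

section \<open>Coloring from lists, one color at a time\<close>

text \<open>
  The hypothesis \<open>kernel\<close> is the fixed point property for majority thresholds. The set \<open>U\<close>
  consists of the undecided vertices, and the remaining vertices carry a forced color \<open>g\<close>;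
  in the recursion, a vertex is satisfied from the moment it is forced, so the majority condition
  is only asked for \<open>U\<close>. To process color \<open>a\<close>, take a kernel \<open>K\<close> of the undecided
  vertices having \<open>a\<close> in their lists. All of these vertices then become forced, while
  the lists of the still undecided ones avoid \<open>a\<close>.
\<close>

lemma list_coloring_from_kernels:
  fixes N :: "'a \<Rightarrow> 'a set" and L :: "'a \<Rightarrow> 'c set"
  assumes kernel: "\<And>S F. S \<subseteq> V \<Longrightarrow>
      \<exists>K \<subseteq> S. \<forall>v \<in> S. v \<in> K \<longleftrightarrow> 2 * card (N v \<inter> (K \<union> F)) \<le> card (N v)"
    and N: "\<And>v. v \<in> V \<Longrightarrow> N v \<subseteq> V" "finite V"
    and "finite C" "U \<subseteq> V"
    and "\<And>v. v \<in> U \<Longrightarrow> L v \<subseteq> C" "\<And>v. v \<in> U \<Longrightarrow> card (L v) = 2"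
  shows "\<exists>c. (\<forall>v \<in> V - U. c v = g v) \<and>
    (\<forall>v \<in> U. c v \<in> L v \<and> 2 * card {w \<in> N v. c w = c v} \<le> card (N v))"
  using assms(4-)
proof (induction C arbitrary: U g rule: finite_induct)
  case empty
  have "U = {}"
  proof (rule equals0I)
    fix v
    assume "v \<in> U"
    from empty(2)[OF this] empty(3)[OF this] show False by simp
  qed
  then show ?case by (intro exI[of _ g]) simp
next
  case (insert a C)
  define S where "S = {v \<in> U. a \<in> L v}"
  define F where "F = {v \<in> V - U. g v = a}"
  have "S \<subseteq> V" using insert.prems(1) by (auto simp: S_def)
  from kernel[OF this, of F] obtain K where K: "K \<subseteq> S"
    "\<And>v. v \<in> S \<Longrightarrow> v \<in> K \<longleftrightarrow> 2 * card (N v \<inter> (K \<union> F)) \<le> card (N v)"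
    by blast
  define b where "b v = (SOME x. x \<in> L v \<and> x \<noteq> a)" for v
  have b: "b v \<in> L v \<and> b v \<noteq> a" if "v \<in> U" for v
    unfolding b_def
  proof (rule someI_ex)
    have "card (L v) = 2" using insert.prems(3) that .
    then obtain x y where "L v = {x, y}" "x \<noteq> y"
      by (auto simp: card_2_iff)
    then show "\<exists>x. x \<in> L v \<and> x \<noteq> a" by auto
  qed
  define g' where "g' v = (if v \<in> K then a else if v \<in> S then b v else g v)" for v
  have "\<exists>c. (\<forall>v \<in> V - (U - S). c v = g' v) \<and>
    (\<forall>v \<in> U - S. c v \<in> L v \<and> 2 * card {w \<in> N v. c w = c v} \<le> card (N v))"
    using insert.prems by (intro insert.IH) (auto simp: S_def)
  then obtain c where forced: "\<And>v. v \<in> V - (U - S) \<Longrightarrow> c v = g' v"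
    and decided: "\<And>v. v \<in> U - S \<Longrightarrow> c v \<in> L v \<and> 2 * card {w \<in> N v. c w = c v} \<le> card (N v)"
    by blast
  have a_class: "c w = a \<longleftrightarrow> w \<in> K \<union> F" if "w \<in> V" for w
  proof (cases "w \<in> U - S")
    case True
    then have "c w \<noteq> a" using decided by (auto simp: S_def)
    then show ?thesis using True K(1) by (auto simp: F_def)
  next
    case False
    then have "c w = g' w" using forced that by blast
    moreover have "w \<in> S \<Longrightarrow> b w \<noteq> a" using b by (auto simp: S_def)
    ultimately show ?thesis using False that K(1) by (auto simp: g'_def F_def S_def)
  qed
  have "c v \<in> L v \<and> 2 * card {w \<in> N v. c w = c v} \<le> card (N v)" if "v \<in> S" for v
  proof -
    have v: "v \<in> U" "v \<in> V" "a \<in> L v" using that \<open>S \<subseteq> V\<close> by (auto simp: S_def)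
    have fin: "finite (N v)" using N v finite_subset by blast
    have eq: "{w \<in> N v. c w = a} = N v \<inter> (K \<union> F)" using a_class N(1)[OF v(2)] by blast
    have cv: "c v = g' v" using forced that v by blast
    show ?thesis
    proof (cases "v \<in> K")
      case True
      then have "c v = a" by (simp add: cv g'_def)
      then show ?thesis using True K(2)[OF that] eq v by simp
    next
      case False
      then have "c v = b v" using that by (simp add: cv g'_def)
      then have "c v \<noteq> a" "c v \<in> L v" using b[OF v(1)] by auto
      have "card (N v) < 2 * card {w \<in> N v. c w = a}" using False K(2)[OF that] eq by simp
      moreover have "card {w \<in> N v. c w = a} + card {w \<in> N v. c w = c v} =
          card ({w \<in> N v. c w = a} \<union> {w \<in> N v. c w = c v})"
        using fin \<open>c v \<noteq> a\<close> by (subst card_Un_disjoint) auto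
      moreover have "\<dots> \<le> card (N v)" using fin by (intro card_mono) auto
      ultimately show ?thesis using \<open>c v \<in> L v\<close> by simp
    qed
  qed
  moreover have "c v = g v" if "v \<in> V - U" for v
    using forced[of v] that K(1) by (auto simp: g'_def S_def)
  ultimately show ?case using decided by (intro exI[of _ c]) blast
qed

section \<open>Majority choosability\<close>

theorem theorem8:
  fixes D :: "('a, 'b) pre_digraph"
  assumes "digraph D"
    and "\<not> (\<exists>p. pre_digraph.cycle D p \<and> odd (length p))"
  shows "majority_choosable TYPE('c) D 2"
proof -
  interpret digraph D by fact
  define N where "N = out_neighbors D"
  have N_Image: "N v = arcs_ends D `` {v}" for v by (auto simp: N_def out_neighbors_def)
  have N_verts: "N v \<subseteq> verts D" for v
    by (auto simp: N_def out_neighbors_def)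
  have fin_N: "finite (N v)" for v using N_verts finite_verts finite_subset by blast
  have even_closed: "even n" if "(x, x) \<in> arcs_ends D ^^ n" for x n
  proof (cases n)
    case (Suc m)
    then have "x \<in> verts D" using that by auto
    from awalk_of_relpow_arcs_ends[OF that this] obtain p where "awalk x p x" "length p = n"
      by blast
    then show ?thesis using odd_closed_walk_imp_odd_cycle[of x p] assms(2) by blast
  qed simp
  have kernel: "\<exists>K \<subseteq> S. \<forall>v \<in> S. v \<in> K \<longleftrightarrow> 2 * card (N v \<inter> (K \<union> F)) \<le> card (N v)"
    if "S \<subseteq> verts D" for S F
  proof (rule antitone_fixed_point[OF even_closed])
    show "finite S" using that finite_verts finite_subset by blast
    show "2 * card (N v \<inter> (X \<union> F)) \<le> card (N v)"
      if "X \<subseteq> Y" "2 * card (N v \<inter> (Y \<union> F)) \<le> card (N v)" for v X Y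
    proof -
      have "card (N v \<inter> (X \<union> F)) \<le> card (N v \<inter> (Y \<union> F))"
        using fin_N that(1) by (intro card_mono) auto
      with that(2) show ?thesis by linarith
    qed
    show "2 * card (N v \<inter> (X \<union> F)) \<le> card (N v) \<longleftrightarrow>
        2 * card (N v \<inter> (X \<inter> arcs_ends D `` {v} \<union> F)) \<le> card (N v)" for v X
    proof -
      have "N v \<inter> (X \<union> F) = N v \<inter> (X \<inter> arcs_ends D `` {v} \<union> F)"
        unfolding N_Image by blast
      then show ?thesis by simp
    qed
  qed
  show ?thesis
    unfolding majority_choosable_def
  proof (intro allI impI)
    fix L :: "'a \<Rightarrow> 'c set"
    assume L: "\<forall>v \<in> verts D. infinite (L v) \<or> 2 \<le> card (L v)"
    have "\<exists>M \<subseteq> L v. card M = 2" if "v \<in> verts D" for v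
    proof (cases "finite (L v)")
      case True
      then have "2 \<le> card (L v)" using L that by blast
      then show ?thesis using obtain_subset_with_card_n[of 2 "L v"] by blast
    next
      case False
      then show ?thesis using infinite_arbitrarily_large[of "L v" 2] by blast
    qed
    then obtain M where M: "\<And>v. v \<in> verts D \<Longrightarrow> M v \<subseteq> L v \<and> card (M v) = 2"
      by metis
    have "finite (\<Union>v \<in> verts D. M v)"
      using M by (intro finite_UN_I) (auto intro: card_ge_0_finite)
    then have "\<exists>c. (\<forall>v \<in> verts D - verts D. c v = undefined v) \<and>
      (\<forall>v \<in> verts D. c v \<in> M v \<and> 2 * card {w \<in> N v. c w = c v} \<le> card (N v))"
      using M N_verts finite_verts
      by (intro list_coloring_from_kernels[where C = "\<Union>v \<in> verts D. M v"] kernel) auto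
    then obtain c where
      "\<forall>v \<in> verts D. c v \<in> M v \<and> 2 * card {w \<in> N v. c w = c v} \<le> card (N v)"
      by blast
    then show "\<exists>c. majority_coloring D c \<and> (\<forall>v \<in> verts D. c v \<in> L v)"
      using M unfolding majority_coloring_def N_def by blast
  qed
qed

end
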